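(* Let $1<p,q<\infty$. Let $\mu,\lambda$ be two finite Borel measures on $G$ and let $\nu$ be a $(p,q)$-frame measure for $\mu$. Suppose that $S:L^p(\lambda)\to L^p(\mu)$ is a bounded invertible (linear) operator. Then $\nu$ is a $(p,q)$-frame measure for $\lambda$ if and only if there exists a constant $M>1$ such that $$\|\widehat{S(f)d\mu}-\widehat{fd\lambda}\|_{L^q(\nu)}\le M\min\left\{\|\widehat{S(f)d\mu}\|_{L^q(\nu)},\ \|\widehat{fd\lambda}\|_{L^q(\nu)}\right\}\quad\text{for all } f\in L^p(\lambda).$$
   Context: $G$ is a locally compact Hausdorff abelian (LCA) group, written additively, which is metrizable and a countable union of compact sets; $\widehat{G}$ is its dual group (continuous characters), and $\langle x,\gamma\rangle$ denotes the value of $\gamma\in\widehat{G}$ at $x\in G$. Measures are non-negative. For a finite Borel measure $\mu$ on $G$ and $f\in L^1(\mu)$, $\widehat{fd\mu}(\gamma)=\int_G f(x)\overline{\langle x,\gamma\rangle}\,d\mu(x)$ for $\gamma\in\widehat{G}$. A Borel measure $\nu$ on $\widehat{G}$ is a $(p,q)$-frame measure for $\mu$ if there are constants $0<A\le B<\infty$ with $A\|f\|_{L^p(\mu)}^q\le\|\widehat{fd\mu}\|_{L^q(\nu)}^q\le B\|f\|_{L^p(\mu)}^q$ for all $f\in L^p(\mu)$. *)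

theory Defs
  imports "HOL-Analysis.Analysis"
begin

definition dual_group :: "('a::topological_ab_group_add \<Rightarrow> complex) set" where
  "dual_group = {\<gamma>. continuous_on UNIV \<gamma> \<and> (\<forall>x. norm (\<gamma> x) = 1) \<and>
                    (\<forall>x y. \<gamma> (x + y) = \<gamma> x * \<gamma> y)}"

text \<open>The dual group carries the compact-open topology. Taking \<open>K\<close> empty shows that the
  underlying set of the generated topology is all of \<^term>\<open>dual_group\<close>.\<close>

definition dual_topology :: "('a::topological_ab_group_add \<Rightarrow> complex) topology" where
  "dual_topology = topology_generated_by
     {{\<gamma> \<in> dual_group. \<gamma> ` K \<subseteq> U} | K U. compact K \<and> open U}"

definition dual_borel :: "('a::topological_ab_group_add \<Rightarrow> complex) measure" where
  "dual_borel = sigma dual_group {V. openin dual_topology V}"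

lemma topspace_dual_topology: "topspace dual_topology = dual_group"
proof -
  have "dual_group \<in> {{\<gamma> \<in> dual_group. \<gamma> ` K \<subseteq> U} | K U. compact (K :: 'a set) \<and> open U}"
    by (rule CollectI, rule exI[of _ "{}"], rule exI[of _ UNIV]) auto
  then show ?thesis
    unfolding dual_topology_def topology_generated_by_topspace by blast
qed

lemma sets_dual_borel:
  "sets dual_borel = sigma_sets dual_group {V. openin dual_topology V}"
  unfolding dual_borel_def
  by (rule sets_measure_of) (use openin_subset topspace_dual_topology in blast)

text \<open>Real powers on \<^typ>\<open>ennreal\<close>, used only for exponents \<open>r > 0\<close>, so that infinity is
  sent to infinity.\<close>

definition epowr :: "ennreal \<Rightarrow> real \<Rightarrow> ennreal" where
  "epowr x r = (if x = \<infinity> then \<infinity> else ennreal (enn2real x powr r))"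

text \<open>The value \<open>\<infinity>\<close> is allowed: a transform need not lie in the \<open>L\<^sup>q\<close> space of a given
  measure on the dual group.\<close>

definition Lp_norm :: "real \<Rightarrow> 'b measure \<Rightarrow> ('b \<Rightarrow> complex) \<Rightarrow> ennreal" where
  "Lp_norm p M f = epowr (\<integral>\<^sup>+ x. ennreal (norm (f x) powr p) \<partial>M) (1 / p)"

definition Lp :: "real \<Rightarrow> 'b measure \<Rightarrow> ('b \<Rightarrow> complex) set" where
  "Lp p M = {f \<in> borel_measurable M. Lp_norm p M f < \<infinity>}"

definition fourier_transform ::
    "'a::topological_ab_group_add measure \<Rightarrow> ('a \<Rightarrow> complex) \<Rightarrow> ('a \<Rightarrow> complex) \<Rightarrow> complex" where
  "fourier_transform \<mu> f \<gamma> = (LINT x|\<mu>. f x * cnj (\<gamma> x))"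

definition frame_measure ::
    "real \<Rightarrow> real \<Rightarrow> 'a::topological_ab_group_add measure \<Rightarrow> ('a \<Rightarrow> complex) measure \<Rightarrow> bool" where
  "frame_measure p q \<mu> \<nu> \<longleftrightarrow>
     sets \<nu> = sets dual_borel \<and>
     (\<exists>A B::real. 0 < A \<and> A \<le> B \<and>
       (\<forall>f \<in> Lp p \<mu>.
          ennreal A * epowr (Lp_norm p \<mu> f) q \<le> epowr (Lp_norm q \<nu> (fourier_transform \<mu> f)) q \<and>
          epowr (Lp_norm q \<nu> (fourier_transform \<mu> f)) q \<le> ennreal B * epowr (Lp_norm p \<mu> f) q))"

text \<open>Elements of \<^term>\<open>Lp p M\<close> are functions rather than almost-everywhere classes. An operator
  between the spaces of classes is therefore given by a map on representatives that respects
  almost-everywhere equality, and all identities between its values hold almost everywhere.\<close>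

definition bounded_Lp_operator ::
    "real \<Rightarrow> 'b measure \<Rightarrow> 'c measure \<Rightarrow> (('b \<Rightarrow> complex) \<Rightarrow> ('c \<Rightarrow> complex)) \<Rightarrow> bool" where
  "bounded_Lp_operator p M N S \<longleftrightarrow>
     (\<forall>f \<in> Lp p M. S f \<in> Lp p N) \<and>
     (\<forall>f \<in> Lp p M. \<forall>g \<in> Lp p M. (AE x in M. f x = g x) \<longrightarrow> (AE y in N. S f y = S g y)) \<and>
     (\<forall>f \<in> Lp p M. \<forall>g \<in> Lp p M. AE y in N. S (\<lambda>x. f x + g x) y = S f y + S g y) \<and>
     (\<forall>c. \<forall>f \<in> Lp p M. AE y in N. S (\<lambda>x. c * f x) y = c * S f y) \<and>
     (\<exists>C::real. \<forall>f \<in> Lp p M. Lp_norm p N (S f) \<le> ennreal C * Lp_norm p M f)"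

definition bounded_invertible_Lp_operator ::
    "real \<Rightarrow> 'b measure \<Rightarrow> 'c measure \<Rightarrow> (('b \<Rightarrow> complex) \<Rightarrow> ('c \<Rightarrow> complex)) \<Rightarrow> bool" where
  "bounded_invertible_Lp_operator p M N S \<longleftrightarrow>
     bounded_Lp_operator p M N S \<and>
     (\<exists>T. bounded_Lp_operator p N M T \<and>
          (\<forall>f \<in> Lp p M. AE x in M. T (S f) x = f x) \<and>
          (\<forall>g \<in> Lp p N. AE y in N. S (T g) y = g y))"

end

theory Submission
  imports Defs
begin

text \<open>Taking \<open>q\<close>-th roots, the frame inequalities say that the norm of \<open>f\<close> and that of its
  transform are comparable up to constants. As \<open>S\<close> and its inverse are bounded, the norms of
  \<open>f\<close>, of \<open>S f\<close> and of the transform of \<open>S f\<close> are always comparable, so \<open>\<nu>\<close> is a frame measure for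
  \<open>lam\<close> iff the transforms of \<open>S f\<close> and \<open>f\<close> have comparable norms; by the triangle inequality this
  is the perturbation condition. The triangle inequality needs measurable transforms: they are
  continuous in the compact-open topology because, by \<open>\<sigma>\<close>-compactness of the group, an integrable
  function has small integral off a suitable compact set.\<close>

section \<open>Powers and constant factors on the extended non-negative reals\<close>

lemma epowr_top [simp]: "epowr top r = top"
  by (simp add: epowr_def)

lemma epowr_ennreal: "0 \<le> a \<Longrightarrow> epowr (ennreal a) r = ennreal (a powr r)"
  by (simp add: epowr_def)

lemma epowr_mono:
  assumes "x \<le> y" "0 \<le> r"
  shows "epowr x r \<le> epowr y r"
proof (cases "y = \<infinity>")
  case False
  then obtain a b where "x = ennreal a" "y = ennreal b" "0 \<le> a" "0 \<le> b"
    using assms(1) by (metis enn2real_nonneg ennreal_enn2real infinity_ennreal_def neq_top_trans top.not_eq_extremum)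
  with assms show ?thesis
    by (simp add: epowr_ennreal ennreal_leI powr_mono2)
qed simp

lemma epowr_epowr: "epowr (epowr x r) s = epowr x (r * s)"
proof (cases "x = \<infinity>")
  case False
  then obtain a where "x = ennreal a" "0 \<le> a"
    by (metis enn2real_nonneg ennreal_enn2real infinity_ennreal_def top.not_eq_extremum)
  then show ?thesis
    by (simp add: epowr_ennreal powr_powr)
qed simp

lemma epowr_one [simp]: "epowr x 1 = x"
proof (cases "x = \<infinity>")
  case False
  then obtain a where "x = ennreal a" "0 \<le> a"
    by (metis enn2real_nonneg ennreal_enn2real infinity_ennreal_def top.not_eq_extremum)
  then show ?thesis
    by (simp add: epowr_ennreal)
qed simp

lemma epowr_mult:
  assumes "0 < c"
  shows "epowr (ennreal c * x) r = ennreal (c powr r) * epowr x r"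
proof (cases "x = \<infinity>")
  case True
  with assms show ?thesis
    by (simp add: ennreal_mult_top epowr_def)
next
  case False
  then obtain a where "x = ennreal a" "0 \<le> a"
    by (metis enn2real_nonneg ennreal_enn2real infinity_ennreal_def top.not_eq_extremum)
  with assms show ?thesis
    by (simp add: epowr_ennreal powr_mult flip: ennreal_mult)
qed

lemma epowr_le_iff:
  assumes "0 < r"
  shows "epowr x r \<le> epowr y r \<longleftrightarrow> x \<le> y"
proof
  assume "epowr x r \<le> epowr y r"
  then have "epowr (epowr x r) (1 / r) \<le> epowr (epowr y r) (1 / r)"
    by (rule epowr_mono) (use assms in simp)
  with assms show "x \<le> y"
    by (simp add: epowr_epowr)
qed (use assms in \<open>auto intro: epowr_mono\<close>)

text \<open>Division by \<open>c\<close> is multiplication by \<open>1 / c\<close>, which inverts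
  \<open>c\<close> also inside \<open>ennreal\<close>; so a constant can change sides even when
  \<open>x\<close> or \<open>y\<close> is infinite.\<close>

lemma ennreal_le_mult_iff:
  assumes "0 < c"
  shows "ennreal c * x \<le> y \<longleftrightarrow> x \<le> ennreal (1 / c) * y"
proof -
  have 1: "ennreal (1 / c) * ennreal c = 1" "ennreal c * ennreal (1 / c) = 1"
    using assms by (simp_all flip: ennreal_mult)
  show ?thesis
  proof
    assume "ennreal c * x \<le> y"
    from mult_left_mono[OF this, of "ennreal (1 / c)"] show "x \<le> ennreal (1 / c) * y"
      by (simp add: 1 flip: mult.assoc)
  next
    assume "x \<le> ennreal (1 / c) * y"
    from mult_left_mono[OF this, of "ennreal c"] show "ennreal c * x \<le> y"
      by (simp add: 1 flip: mult.assoc)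
  qed
qed

text \<open>The tool for chaining comparisons of norms: the constants multiply, and infinite norms
  are allowed throughout.\<close>

lemma ennreal_mult_le_trans:
  assumes "x \<le> ennreal a * y" "y \<le> ennreal b * z" "0 \<le> a"
  shows "x \<le> ennreal (a * b) * z"
proof -
  have "x \<le> ennreal a * (ennreal b * z)"
    using assms by (meson mult_left_mono order_trans zero_le)
  then show ?thesis
    using assms(3) by (simp add: ennreal_mult' mult.assoc)
qed

section \<open>Norms and integrability\<close>

lemma Lp_norm_cong_AE:
  assumes "AE x in M. f x = g x"
  shows "Lp_norm p M f = Lp_norm p M g"
proof -
  have "(\<integral>\<^sup>+ x. ennreal (norm (f x) powr p) \<partial>M) = (\<integral>\<^sup>+ x. ennreal (norm (g x) powr p) \<partial>M)"
    using assms by (intro nn_integral_cong_AE) auto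
  then show ?thesis
    by (simp add: Lp_norm_def)
qed

text \<open>A quasi-triangle inequality suffices, and it is stated for a pointwise bound to cover
  sums and differences at once.\<close>

lemma Lp_norm_le_max:
  assumes [measurable]: "f \<in> borel_measurable M" "g \<in> borel_measurable M"
    and le: "\<And>x. norm (h x) \<le> norm (f x) + norm (g x)"
    and q: "1 \<le> q"
  shows "Lp_norm q M h \<le> ennreal 4 * max (Lp_norm q M f) (Lp_norm q M g)"
proof -
  define I where "I = (\<lambda>u. \<integral>\<^sup>+ x. ennreal (norm (u x :: complex) powr q) \<partial>M)"
  \<comment> \<open>A sum of two norms is at most twice the larger one, whence the factor
    \<open>2 powr q\<close>.\<close>
  have pw: "norm (h x) powr q \<le> 2 powr q * (norm (f x) powr q + norm (g x) powr q)" for x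
  proof -
    let ?m = "max (norm (f x)) (norm (g x))"
    have "norm (h x) powr q \<le> (2 * ?m) powr q"
      using le[of x] q by (intro powr_mono2) auto
    also have "\<dots> = 2 powr q * ?m powr q"
      by (simp add: powr_mult)
    also have "?m powr q \<le> norm (f x) powr q + norm (g x) powr q"
      by (simp add: max_def)
    finally show ?thesis by simp
  qed
  have "I h \<le> (\<integral>\<^sup>+ x. ennreal (2 powr q) * (ennreal (norm (f x) powr q) + ennreal (norm (g x) powr q)) \<partial>M)"
    unfolding I_def using pw
    by (intro nn_integral_mono) (simp add: ennreal_leI flip: ennreal_mult ennreal_plus)
  also have "\<dots> = ennreal (2 powr q) * (I f + I g)"
    unfolding I_def by (simp add: nn_integral_cmult nn_integral_add)
  also have "I f + I g \<le> ennreal 2 * max (I f) (I g)"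
  proof -
    have "I f + I g \<le> max (I f) (I g) + max (I f) (I g)"
      by (intro add_mono) auto
    then show ?thesis by (simp add: mult_2)
  qed
  finally have "I h \<le> ennreal (2 powr q * 2) * max (I f) (I g)"
    by (simp add: ennreal_mult mult.assoc mult_left_mono)
  then have "epowr (I h) (1 / q) \<le> epowr (ennreal (2 powr q * 2) * max (I f) (I g)) (1 / q)"
    using q by (intro epowr_mono) auto
  also have "\<dots> = ennreal ((2 powr q * 2) powr (1 / q)) * epowr (max (I f) (I g)) (1 / q)"
    by (rule epowr_mult) simp
  also have "\<dots> \<le> ennreal 4 * max (epowr (I f) (1 / q)) (epowr (I g) (1 / q))"
  \<comment> \<open>As \<open>1 \<le> q\<close>, the root of the constant is 2 times a number at
    most 2, so 4 serves for all exponents.\<close>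
  proof (rule mult_mono)
    have "(2 powr q * 2) powr (1 / q) = 2 * 2 powr (1 / q)"
      using q by (simp add: powr_mult powr_powr)
    also have "2 powr (1 / q) \<le> (2::real) powr 1"
      using q by (intro powr_mono) auto
    finally show "ennreal ((2 powr q * 2) powr (1 / q)) \<le> ennreal 4"
      by (intro ennreal_leI) simp
  qed (auto simp: max_def)
  finally show ?thesis
    by (simp add: I_def Lp_norm_def)
qed

text \<open>Pointwise |f| is at most 1 + |f|^p, and constants are integrable for a finite
  measure.\<close>

lemma Lp_imp_integrable:
  assumes "finite_measure M" "1 \<le> p" "f \<in> Lp p M"
  shows "integrable M f"
proof -
  interpret finite_measure M by fact
  have [measurable]: "f \<in> borel_measurable M" and fin: "Lp_norm p M f < \<infinity>"
    using assms(3) by (auto simp: Lp_def)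
  have "(\<integral>\<^sup>+ x. ennreal (norm (f x) powr p) \<partial>M) < \<infinity>"
    using fin by (auto simp: Lp_norm_def epowr_def less_top split: if_splits)
  then have "integrable M (\<lambda>x. norm (f x) powr p)"
    by (intro integrableI_bounded) auto
  then have "integrable M (\<lambda>x. 1 + norm (f x) powr p)"
    by auto
  then show ?thesis
  proof (rule Bochner_Integration.integrable_bound)
    have "norm (f x) \<le> 1 + norm (f x) powr p" for x
    proof (cases "norm (f x) \<le> 1")
      case False
      then have "norm (f x) powr 1 \<le> norm (f x) powr p"
        using assms(2) by (intro powr_mono) auto
      with False show ?thesis by (simp add: powr_one)
    qed (simp add: add_increasing2)
    then show "AE x in M. norm (f x) \<le> norm (1 + norm (f x) powr p)"
      by (auto simp: abs_of_nonneg)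
  qed measurable
qed

section \<open>Continuity and measurability of Fourier transforms\<close>

text \<open>A subbasic open set only controls into which open set a compact set is mapped. Total
  boundedness of the image of \<open>K\<close> cuts \<open>K\<close> into finitely many compact
  pieces on which \<open>\<gamma>\<^sub>0\<close> is nearly constant; one subbasic condition per
  piece then forces uniform closeness on \<open>K\<close>.\<close>

lemma dual_topology_uniform_nbhd:
  fixes K :: "'a::topological_ab_group_add set"
  assumes "\<gamma>\<^sub>0 \<in> dual_group" "compact K" "0 < e"
  obtains V where "openin dual_topology V" "\<gamma>\<^sub>0 \<in> V"
    "\<And>\<gamma> x. \<gamma> \<in> V \<Longrightarrow> x \<in> K \<Longrightarrow> norm (\<gamma> x - \<gamma>\<^sub>0 x) < e"
proof -
  have cont: "continuous_on UNIV \<gamma>\<^sub>0"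
    using assms(1) by (simp add: dual_group_def)
  define r where "r = e / 3"
  have r: "0 < r" using assms(3) by (simp add: r_def)
  have "compact (\<gamma>\<^sub>0 ` K)"
    by (rule compact_continuous_image[OF continuous_on_subset[OF cont] assms(2)]) simp
  then obtain Z where Z: "finite Z" "\<gamma>\<^sub>0 ` K \<subseteq> (\<Union>z\<in>Z. ball z r)"
    using r unfolding compact_eq_totally_bounded by blast
  \<comment> \<open>Closed balls keep the pieces compact. The larger open radius
    \<open>2 * r\<close> used in \<open>N z\<close> ensures that \<open>\<gamma>\<^sub>0\<close>
    itself meets the condition; both radii add up to \<open>3 * r\<close>, which is
    \<open>e\<close>.\<close>
  define L where "L z = K \<inter> \<gamma>\<^sub>0 -` cball z r" for z
  have "compact (L z)" for z
  proof -
    have "closed (\<gamma>\<^sub>0 -` cball z r)"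
      using cont by (rule closed_vimage[OF closed_cball])
    then show ?thesis
      unfolding L_def using assms(2) by (rule compact_Int_closed[rotated])
  qed
  define N where "N z = {\<gamma> \<in> dual_group. \<gamma> ` L z \<subseteq> ball z (2 * r)}" for z
  have N: "openin dual_topology (N z)" for z
    unfolding dual_topology_def N_def using \<open>compact (L z)\<close>
    by (intro topology_generated_by_Basis) (auto intro!: exI[of _ "L z"] exI[of _ "ball z (2 * r)"])
  \<comment> \<open>For empty \<open>Z\<close> the intersection alone would be the universal set;
    the factor \<open>topspace dual_topology\<close> turns it into the whole dual group, which is
    open.\<close>
  define V where "V = topspace dual_topology \<inter> (\<Inter>z\<in>Z. N z)"
  show thesis
  proof
    show "openin dual_topology V"
      unfolding V_def
    proof (cases "Z = {}")
      case False
      then show "openin dual_topology (topspace dual_topology \<inter> (\<Inter>z\<in>Z. N z))"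
        using N Z(1) by (intro openin_Int openin_topspace openin_INT2) auto
    qed simp
    show "\<gamma>\<^sub>0 \<in> V"
      using assms(1) r by (auto simp: V_def N_def L_def topspace_dual_topology)
    fix \<gamma> x assume "\<gamma> \<in> V" "x \<in> K"
    from Z(2) \<open>x \<in> K\<close> obtain z where z: "z \<in> Z" "dist z (\<gamma>\<^sub>0 x) < r"
      by auto
    then have "x \<in> L z" using \<open>x \<in> K\<close> by (auto simp: L_def)
    with \<open>\<gamma> \<in> V\<close> z(1) have "dist z (\<gamma> x) < 2 * r"
      by (auto simp: V_def N_def dest!: bspec[of Z _ z])
    with z(2) have "dist (\<gamma> x) (\<gamma>\<^sub>0 x) < 3 * r"
      using dist_triangle2[of "\<gamma> x" "\<gamma>\<^sub>0 x" z] by (simp add: dist_commute)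
    then show "norm (\<gamma> x - \<gamma>\<^sub>0 x) < e"
      by (simp add: r_def dist_norm)
  qed
qed

text \<open>The integral is split at a compact set: on it nearby characters are uniformly close to
  \<open>\<gamma>\<^sub>0\<close>, while off it two characters differ by at most 2 and
  \<open>f\<close> has little mass.\<close>

lemma fourier_transform_continuous_at:
  fixes \<mu> :: "'a::{topological_ab_group_add, t2_space} measure" and K :: "nat \<Rightarrow> 'a set"
  assumes sets: "sets \<mu> = sets borel" and f: "integrable \<mu> f"
    and K: "\<And>n. compact (K n)" "(\<Union>n. K n) = UNIV"
    and \<gamma>\<^sub>0: "\<gamma>\<^sub>0 \<in> dual_group" and e: "0 < e"
  obtains V where "openin dual_topology V" "\<gamma>\<^sub>0 \<in> V"
    "\<And>\<gamma>. \<gamma> \<in> V \<Longrightarrow> dist (fourier_transform \<mu> f \<gamma>) (fourier_transform \<mu> f \<gamma>\<^sub>0) < e"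
proof -
  have [measurable]: "f \<in> borel_measurable \<mu>"
    using f by auto
  \<comment> \<open>These compact sets increase to the whole group, so by dominated convergence the
    integral of |f| over their complements tends to 0.\<close>
  define U where "U n = (\<Union>i\<le>n. K i)" for n
  have compU: "compact (U n)" for n
    unfolding U_def using K(1) by (intro compact_UN) auto
  then have [measurable]: "U n \<in> sets \<mu>" for n
    by (simp add: sets compact_imp_closed)
  have "(\<lambda>n. \<integral>x. norm (f x) * indicator (- U n) x \<partial>\<mu>) \<longlonglongrightarrow> (\<integral>x. (0::real) \<partial>\<mu>)"
  proof (rule integral_dominated_convergence[where w = "\<lambda>x. norm (f x)"])
    show "AE x in \<mu>. (\<lambda>n. norm (f x) * indicator (- U n) x) \<longlonglongrightarrow> 0"
    proof (rule AE_I2)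
      fix x
      obtain m where "x \<in> K m" using K(2) by auto
      then have "x \<in> U n" if "n \<ge> m" for n
        using that by (auto simp: U_def)
      then have "eventually (\<lambda>n. norm (f x) * indicator (- U n) x = 0) sequentially"
        by (auto simp: eventually_sequentially intro!: exI[of _ m])
      then show "(\<lambda>n. norm (f x) * indicator (- U n) x) \<longlonglongrightarrow> 0"
        by (rule tendsto_eventually)
    qed
    have "- U n \<in> sets \<mu>" for n
      using compU[of n] by (simp add: sets compact_imp_closed borel_open open_Compl)
    then show "(\<lambda>x. norm (f x) * indicator (- U n) x) \<in> borel_measurable \<mu>" for n
      by measurable
  qed (use f in \<open>auto simp: indicator_def\<close>)
  then have "eventually (\<lambda>n. (\<integral>x. norm (f x) * indicator (- U n) x \<partial>\<mu>) < e / 4) sequentially"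
    using e by (intro order_tendstoD(2)) auto
  then obtain n where n: "(\<integral>x. norm (f x) * indicator (- U n) x \<partial>\<mu>) < e / 4"
    by (auto simp: eventually_sequentially)
  define J where "J = (\<integral>x. norm (f x) \<partial>\<mu>)"
  have J: "0 \<le> J" by (simp add: J_def)
  \<comment> \<open>The compact set contributes at most \<open>d * J\<close>, less than
    \<open>e / 2\<close>; its complement contributes less than twice \<open>e / 4\<close>. The
    summand 1 avoids division by zero when \<open>J\<close> vanishes.\<close>
  define d where "d = e / (2 * (J + 1))"
  have d: "0 < d" "d * J < e / 2"
    using J e by (auto simp: d_def field_simps)
  obtain V where V: "openin dual_topology V" "\<gamma>\<^sub>0 \<in> V"
    "\<And>\<gamma> x. \<gamma> \<in> V \<Longrightarrow> x \<in> U n \<Longrightarrow> norm (\<gamma> x - \<gamma>\<^sub>0 x) < d"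
    using dual_topology_uniform_nbhd[OF \<gamma>\<^sub>0 compU d(1)] by metis
  \<comment> \<open>Characters are unimodular and continuous, so the product is measurable and
    dominated by \<open>f\<close>.\<close>
  have bd: "integrable \<mu> (\<lambda>x. f x * cnj (\<gamma> x))" if "\<gamma> \<in> dual_group" for \<gamma>
  proof (rule Bochner_Integration.integrable_bound[OF f])
    have "\<gamma> \<in> borel_measurable \<mu>"
      using that borel_measurable_continuous_onI[of \<gamma>]
      by (simp add: dual_group_def measurable_cong_sets[OF sets refl])
    then have "(\<lambda>x. cnj (\<gamma> x)) \<in> borel_measurable \<mu>"
      by (rule borel_measurable_continuous_on[rotated]) (intro continuous_intros)
    then show "(\<lambda>x. f x * cnj (\<gamma> x)) \<in> borel_measurable \<mu>"
      by measurable
  qed (use that in \<open>auto simp: dual_group_def norm_mult\<close>)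
  have "dist (fourier_transform \<mu> f \<gamma>) (fourier_transform \<mu> f \<gamma>\<^sub>0) < e" if "\<gamma> \<in> V" for \<gamma>
  proof -
    have \<gamma>: "\<gamma> \<in> dual_group"
      using openin_subset[OF V(1)] that by (auto simp: topspace_dual_topology)
    have "- U n \<in> sets \<mu>"
      using compU[of n] by (simp add: sets compact_imp_closed borel_open open_Compl)
    then have int2: "integrable \<mu> (\<lambda>x. norm (f x) * indicator (- U n) x)"
      using f by (intro integrable_real_mult_indicator) auto
    have "fourier_transform \<mu> f \<gamma> - fourier_transform \<mu> f \<gamma>\<^sub>0
        = (\<integral>x. f x * cnj (\<gamma> x) - f x * cnj (\<gamma>\<^sub>0 x) \<partial>\<mu>)"
      unfolding fourier_transform_def using bd[OF \<gamma>] bd[OF \<gamma>\<^sub>0]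
      by (rule Bochner_Integration.integral_diff[symmetric])
    also have "norm \<dots> \<le> (\<integral>x. d * norm (f x) + 2 * (norm (f x) * indicator (- U n) x) \<partial>\<mu>)"
    proof (rule order_trans[OF integral_norm_bound integral_mono])
      fix x
      have eq: "norm (f x * cnj (\<gamma> x) - f x * cnj (\<gamma>\<^sub>0 x)) = norm (f x) * norm (\<gamma> x - \<gamma>\<^sub>0 x)"
        by (metis complex_cnj_diff complex_mod_cnj norm_mult right_diff_distrib)
      show "norm (f x * cnj (\<gamma> x) - f x * cnj (\<gamma>\<^sub>0 x))
          \<le> d * norm (f x) + 2 * (norm (f x) * indicator (- U n) x)"
      proof (cases "x \<in> U n")
        case True
        then show ?thesis
          using mult_left_mono[OF less_imp_le[OF V(3)[OF that True]], of "norm (f x)"]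
          unfolding eq by (simp add: mult.commute)
      next
        case False
        have "norm (\<gamma> x - \<gamma>\<^sub>0 x) \<le> norm (\<gamma> x) + norm (\<gamma>\<^sub>0 x)"
          by (rule norm_triangle_ineq4)
        then have "norm (\<gamma> x - \<gamma>\<^sub>0 x) \<le> 2"
          using \<gamma> \<gamma>\<^sub>0 by (simp add: dual_group_def)
        then have "norm (f x) * norm (\<gamma> x - \<gamma>\<^sub>0 x) \<le> norm (f x) * 2"
          by (intro mult_left_mono) auto
        moreover have "0 \<le> d * norm (f x)" using d by simp
        ultimately show ?thesis
          using False unfolding eq by simp
      qed
    qed (use bd[OF \<gamma>] bd[OF \<gamma>\<^sub>0] f int2 in auto)
    also have "\<dots> = d * J + 2 * (\<integral>x. norm (f x) * indicator (- U n) x \<partial>\<mu>)"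
      unfolding J_def using f int2 by (subst Bochner_Integration.integral_add) auto
    also have "\<dots> < e"
      using n d by simp
    finally show ?thesis by (simp add: dist_norm)
  qed
  with V(1,2) that show thesis by blast
qed

text \<open>By continuity, preimages of open sets are open in the dual group, and the open sets
  generate its Borel sets.\<close>

lemma fourier_transform_measurable:
  fixes \<mu> :: "'a::{topological_ab_group_add, t2_space} measure" and K :: "nat \<Rightarrow> 'a set"
  assumes "sets \<mu> = sets borel" "integrable \<mu> f"
    and "\<And>n. compact (K n)" "(\<Union>n. K n) = UNIV"
    and "sets \<nu> = sets dual_borel"
  shows "fourier_transform \<mu> f \<in> borel_measurable \<nu>"
proof -
  have sp: "space dual_borel = (dual_group :: ('a \<Rightarrow> complex) set)"
    unfolding dual_borel_def
    by (rule space_measure_of) (use openin_subset topspace_dual_topology in blast)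
  have "fourier_transform \<mu> f \<in> borel_measurable dual_borel"
  proof (rule borel_measurableI)
    fix W :: "complex set" assume W: "open W"
    have "openin dual_topology (fourier_transform \<mu> f -` W \<inter> dual_group)"
    proof (subst openin_subopen, intro ballI)
      fix \<gamma>\<^sub>0 assume \<gamma>\<^sub>0: "\<gamma>\<^sub>0 \<in> fourier_transform \<mu> f -` W \<inter> dual_group"
      with W obtain e where e: "0 < e" "ball (fourier_transform \<mu> f \<gamma>\<^sub>0) e \<subseteq> W"
        by (auto simp: open_contains_ball)
      obtain V where V: "openin dual_topology V" "\<gamma>\<^sub>0 \<in> V"
        "\<And>\<gamma>. \<gamma> \<in> V \<Longrightarrow> dist (fourier_transform \<mu> f \<gamma>) (fourier_transform \<mu> f \<gamma>\<^sub>0) < e"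
        using fourier_transform_continuous_at[OF assms(1-4) _ e(1)] \<gamma>\<^sub>0 by blast
      have "V \<subseteq> fourier_transform \<mu> f -` W \<inter> dual_group"
        using openin_subset[OF V(1)] V(3) e(2)
        by (auto simp: topspace_dual_topology dist_commute subset_iff)
      with V show "\<exists>T. openin dual_topology T \<and> \<gamma>\<^sub>0 \<in> T \<and> T \<subseteq> fourier_transform \<mu> f -` W \<inter> dual_group"
        by blast
    qed
    then show "fourier_transform \<mu> f -` W \<inter> space dual_borel \<in> sets dual_borel"
      by (auto simp: sp sets_dual_borel)
  qed
  then show ?thesis
    by (simp add: measurable_cong_sets[OF assms(5) refl])
qed

section \<open>Frame inequalities and invertible operators in terms of norms\<close>

text \<open>The inequalities without \<open>q\<close>-th powers, each bounding one norm by a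
  multiple of the other, so that they can be chained.\<close>

lemma frame_measure_iff:
  fixes \<mu> :: "'a::topological_ab_group_add measure"
  assumes q: "0 < q"
  shows "frame_measure p q \<mu> \<nu> \<longleftrightarrow> sets \<nu> = sets dual_borel \<and>
    (\<exists>a b. 0 < a \<and> 0 < b \<and> (\<forall>f \<in> Lp p \<mu>.
       Lp_norm p \<mu> f \<le> ennreal a * Lp_norm q \<nu> (fourier_transform \<mu> f) \<and>
       Lp_norm q \<nu> (fourier_transform \<mu> f) \<le> ennreal b * Lp_norm p \<mu> f))"
proof -
  have lower: "ennreal (c powr q) * epowr x q \<le> epowr y q \<longleftrightarrow> x \<le> ennreal (1 / c) * y"
    and upper: "epowr y q \<le> ennreal (c powr q) * epowr x q \<longleftrightarrow> y \<le> ennreal c * x"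
    if "0 < c" for c x y
    using that q by (simp_all add: epowr_le_iff ennreal_le_mult_iff flip: epowr_mult)
  have root: "(c powr (1 / q)) powr q = c" if "0 < c" for c
    using that q by (simp add: powr_powr)
  show ?thesis (is "_ \<longleftrightarrow> _ \<and> ?R")
  proof (intro iffI conjI; (elim conjE)?)
    assume fm: "frame_measure p q \<mu> \<nu>"
    then show "sets \<nu> = sets dual_borel"
      by (simp add: frame_measure_def)
    from fm obtain A B where AB: "0 < A" "A \<le> B" and *: "\<forall>f \<in> Lp p \<mu>.
          ennreal A * epowr (Lp_norm p \<mu> f) q \<le> epowr (Lp_norm q \<nu> (fourier_transform \<mu> f)) q \<and>
          epowr (Lp_norm q \<nu> (fourier_transform \<mu> f)) q \<le> ennreal B * epowr (Lp_norm p \<mu> f) q"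
      by (auto simp: frame_measure_def)
    \<comment> \<open>The constants are the \<open>q\<close>-th roots of the frame bounds, the lower
      one inverted.\<close>
    then show ?R
      using lower[of "A powr (1 / q)"] upper[of "B powr (1 / q)"] root[of A] root[of B]
      by (intro exI[of _ "1 / A powr (1 / q)"] exI[of _ "B powr (1 / q)"]) auto
  next
    assume sets: "sets \<nu> = sets dual_borel" and ?R
    then obtain a b where ab: "0 < a" "0 < b" and lo: "\<And>f. f \<in> Lp p \<mu> \<Longrightarrow>
       Lp_norm p \<mu> f \<le> ennreal a * Lp_norm q \<nu> (fourier_transform \<mu> f)"
      and up: "\<And>f. f \<in> Lp p \<mu> \<Longrightarrow> Lp_norm q \<nu> (fourier_transform \<mu> f) \<le> ennreal b * Lp_norm p \<mu> f"
      by auto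
    \<comment> \<open>The lower frame bound will be \<open>(1 / a) powr q\<close>; enlarging
      \<open>b\<close> to at least \<open>1 / a\<close> makes the upper bound no smaller than the
      lower one, as the definition demands.\<close>
    define c where "c = max b (1 / a)"
    have c: "0 < c" "1 / a \<le> c" using ab by (auto simp: c_def)
    have up': "Lp_norm q \<nu> (fourier_transform \<mu> f) \<le> ennreal c * Lp_norm p \<mu> f" if "f \<in> Lp p \<mu>" for f
      using up[OF that] by (rule order_trans) (auto simp: c_def intro!: mult_right_mono ennreal_leI)
    show "frame_measure p q \<mu> \<nu>"
      unfolding frame_measure_def
    proof (rule conjI[OF sets], rule exI[of _ "(1 / a) powr q"], rule exI[of _ "c powr q"],
        intro conjI ballI)
      show "0 < (1 / a) powr q" using ab by simp
      show "(1 / a) powr q \<le> c powr q" using c ab q by (intro powr_mono2) auto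
      show "ennreal ((1 / a) powr q) * epowr (Lp_norm p \<mu> f) q
          \<le> epowr (Lp_norm q \<nu> (fourier_transform \<mu> f)) q" if "f \<in> Lp p \<mu>" for f
        using lo[OF that] ab by (subst lower) auto
      show "epowr (Lp_norm q \<nu> (fourier_transform \<mu> f)) q \<le> ennreal (c powr q) * epowr (Lp_norm p \<mu> f) q"
        if "f \<in> Lp p \<mu>" for f
        using up'[OF that] c by (subst upper) auto
    qed
  qed
qed

text \<open>The constant in the definition is an arbitrary real; its maximum with 1 is a positive
  bound.\<close>

lemma bounded_Lp_operator_bound:
  assumes "bounded_Lp_operator p M N S"
  obtains C where "0 < C" "\<And>f. f \<in> Lp p M \<Longrightarrow> Lp_norm p N (S f) \<le> ennreal C * Lp_norm p M f"
proof -
  obtain C where C: "\<And>f. f \<in> Lp p M \<Longrightarrow> Lp_norm p N (S f) \<le> ennreal C * Lp_norm p M f"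
    using assms unfolding bounded_Lp_operator_def by blast
  show thesis
  proof
    show "Lp_norm p N (S f) \<le> ennreal (max C 1) * Lp_norm p M f" if "f \<in> Lp p M" for f
      using C[OF that] by (rule order_trans) (auto intro!: mult_right_mono ennreal_leI)
  qed simp
qed

text \<open>The last bound is boundedness of the inverse \<open>T\<close> applied to
  \<open>S f\<close>: since \<open>T (S f)\<close> equals \<open>f\<close> almost everywhere, both
  have the same norm.\<close>

lemma bounded_invertible_Lp_operator_bounds:
  assumes "bounded_invertible_Lp_operator p M N S"
  obtains C D where "0 < C" "0 < D" "\<And>f. f \<in> Lp p M \<Longrightarrow> S f \<in> Lp p N"
    "\<And>f. f \<in> Lp p M \<Longrightarrow> Lp_norm p N (S f) \<le> ennreal C * Lp_norm p M f"
    "\<And>f. f \<in> Lp p M \<Longrightarrow> Lp_norm p M f \<le> ennreal D * Lp_norm p N (S f)"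
proof -
  obtain T where S: "bounded_Lp_operator p M N S" and T: "bounded_Lp_operator p N M T"
    and TS: "\<And>f. f \<in> Lp p M \<Longrightarrow> AE x in M. T (S f) x = f x"
    using assms by (auto simp: bounded_invertible_Lp_operator_def)
  obtain C where C: "0 < C" "\<And>f. f \<in> Lp p M \<Longrightarrow> Lp_norm p N (S f) \<le> ennreal C * Lp_norm p M f"
    using bounded_Lp_operator_bound[OF S] by blast
  obtain D where D: "0 < D" "\<And>g. g \<in> Lp p N \<Longrightarrow> Lp_norm p M (T g) \<le> ennreal D * Lp_norm p N g"
    using bounded_Lp_operator_bound[OF T] by blast
  have mem: "S f \<in> Lp p N" if "f \<in> Lp p M" for f
    using S that by (auto simp: bounded_Lp_operator_def)
  show thesis
  proof (rule that[OF C(1) D(1) mem C(2)])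
    fix f assume f: "f \<in> Lp p M"
    show "Lp_norm p M f \<le> ennreal D * Lp_norm p N (S f)"
      using D(2)[OF mem[OF f]] Lp_norm_cong_AE[OF TS[OF f]] by simp
  qed
qed

section \<open>Equivalence of the frame property and the perturbation condition\<close>

theorem theorem3p11:
  fixes \<mu> lam :: "'a::{topological_ab_group_add, t2_space} measure"
    and \<nu> :: "('a \<Rightarrow> complex) measure"
    and S :: "('a \<Rightarrow> complex) \<Rightarrow> ('a \<Rightarrow> complex)"
    and p q :: real
  assumes "locally_compact_space (euclidean :: 'a topology)"
    and "metrizable_space (euclidean :: 'a topology)"
    and "\<exists>K :: nat \<Rightarrow> 'a set. (\<forall>n. compact (K n)) \<and> (\<Union>n. K n) = UNIV"
    and "1 < p" and "1 < q"
    and "finite_measure \<mu>" and "sets \<mu> = sets borel"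
    and "finite_measure lam" and "sets lam = sets borel"
    and "frame_measure p q \<mu> \<nu>"
    and "bounded_invertible_Lp_operator p lam \<mu> S"
  shows "frame_measure p q lam \<nu> \<longleftrightarrow>
    (\<exists>M::real. M > 1 \<and>
      (\<forall>f \<in> Lp p lam.
        Lp_norm q \<nu> (\<lambda>\<gamma>. fourier_transform \<mu> (S f) \<gamma> - fourier_transform lam f \<gamma>)
        \<le> ennreal M * min (Lp_norm q \<nu> (fourier_transform \<mu> (S f)))
                           (Lp_norm q \<nu> (fourier_transform lam f))))"
proof -
  obtain K :: "nat \<Rightarrow> 'a set" where K: "\<And>n. compact (K n)" "(\<Union>n. K n) = UNIV"
    using assms(3) by auto
  have q: "0 < q" "1 \<le> q" using \<open>1 < q\<close> by auto
  obtain a b where sets: "sets \<nu> = sets dual_borel" and ab: "0 < a" "0 < b"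
    and lo: "\<And>g. g \<in> Lp p \<mu> \<Longrightarrow> Lp_norm p \<mu> g \<le> ennreal a * Lp_norm q \<nu> (fourier_transform \<mu> g)"
    and up: "\<And>g. g \<in> Lp p \<mu> \<Longrightarrow> Lp_norm q \<nu> (fourier_transform \<mu> g) \<le> ennreal b * Lp_norm p \<mu> g"
    using \<open>frame_measure p q \<mu> \<nu>\<close> unfolding frame_measure_iff[OF q(1)] by blast
  obtain C D where CD: "0 < C" "0 < D" and S: "\<And>f. f \<in> Lp p lam \<Longrightarrow> S f \<in> Lp p \<mu>"
    and C: "\<And>f. f \<in> Lp p lam \<Longrightarrow> Lp_norm p \<mu> (S f) \<le> ennreal C * Lp_norm p lam f"
    and D: "\<And>f. f \<in> Lp p lam \<Longrightarrow> Lp_norm p lam f \<le> ennreal D * Lp_norm p \<mu> (S f)"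
    using bounded_invertible_Lp_operator_bounds[OF assms(11)] by blast
  define F where "F f = fourier_transform \<mu> (S f)" for f
  define G where "G f = fourier_transform lam f" for f
  let ?n = "Lp_norm q \<nu>"
  let ?d = "\<lambda>f. ?n (\<lambda>\<gamma>. F f \<gamma> - G f \<gamma>)"
  have meas [measurable]: "F f \<in> borel_measurable \<nu>" "G f \<in> borel_measurable \<nu>" if "f \<in> Lp p lam" for f
    unfolding F_def G_def using assms S[OF that] that
    by (auto intro!: fourier_transform_measurable[OF _ _ K sets] Lp_imp_integrable[where p = p])
  \<comment> \<open>Boundedness of \<open>S\<close> and of its inverse, combined with the frame
    inequalities for \<open>\<mu>\<close>, makes the norm of \<open>F f\<close> comparable to that
    of \<open>f\<close>.\<close>
  have F_up: "?n (F f) \<le> ennreal (b * C) * Lp_norm p lam f" if "f \<in> Lp p lam" for f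
    unfolding F_def using ennreal_mult_le_trans[OF up[OF S[OF that]] C[OF that]] ab by simp
  have F_lo: "Lp_norm p lam f \<le> ennreal (D * a) * ?n (F f)" if "f \<in> Lp p lam" for f
    unfolding F_def using ennreal_mult_le_trans[OF D[OF that] lo[OF S[OF that]]] CD by simp
  have "frame_measure p q lam \<nu> \<longleftrightarrow>
      (\<exists>M>1. \<forall>f \<in> Lp p lam. ?d f \<le> ennreal M * min (?n (F f)) (?n (G f)))"
  proof
    assume "frame_measure p q lam \<nu>"
    then obtain c d where cd: "0 < c" "0 < d"
      and G_lo: "\<And>f. f \<in> Lp p lam \<Longrightarrow> Lp_norm p lam f \<le> ennreal c * ?n (G f)"
      and G_up: "\<And>f. f \<in> Lp p lam \<Longrightarrow> ?n (G f) \<le> ennreal d * Lp_norm p lam f"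
      unfolding frame_measure_iff[OF q(1)] G_def by blast
    \<comment> \<open>The first product bounds \<open>F f\<close> by \<open>G f\<close>, the second
      \<open>G f\<close> by \<open>F f\<close>, each passing through the norm of \<open>f\<close>.
      With 1 included, \<open>k\<close> also compares each norm with itself, so the maximum is at
      most \<open>k\<close> times the minimum.\<close>
    define k where "k = max 1 (max (b * C * c) (d * (D * a)))"
    have k: "1 \<le> k" by (simp add: k_def)
    show "\<exists>M>1. \<forall>f \<in> Lp p lam. ?d f \<le> ennreal M * min (?n (F f)) (?n (G f))"
    proof (intro exI[of _ "4 * k"] conjI ballI)
      fix f assume f: "f \<in> Lp p lam"
      have le: "x \<le> ennreal k * y" if "x \<le> ennreal s * y" "s \<le> k" for x y s
        using that by (meson ennreal_leI mult_right_mono order_trans zero_le)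
      have FG: "?n (F f) \<le> ennreal k * ?n (G f)"
        using ennreal_mult_le_trans[OF F_up[OF f] G_lo[OF f]] ab CD
        by (intro le[of _ "b * C * c"]) (auto simp: k_def)
      have GF: "?n (G f) \<le> ennreal k * ?n (F f)"
        using ennreal_mult_le_trans[OF G_up[OF f] F_lo[OF f]] cd
        by (intro le[of _ "d * (D * a)"]) (auto simp: k_def)
      have self: "x \<le> ennreal k * x" for x
        using k by (intro le[of _ 1]) auto
      have "max (?n (F f)) (?n (G f)) \<le> ennreal k * min (?n (F f)) (?n (G f))"
        using FG GF self by (auto simp: min_def)
      with Lp_norm_le_max[OF meas[OF f] norm_triangle_ineq4 q(2)]
      show "?d f \<le> ennreal (4 * k) * min (?n (F f)) (?n (G f))"
        by (rule ennreal_mult_le_trans) simp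
    qed (use k in simp)
  next
    assume "\<exists>M>1. \<forall>f \<in> Lp p lam. ?d f \<le> ennreal M * min (?n (F f)) (?n (G f))"
    then obtain M where M: "1 < M"
      and d: "\<And>f. f \<in> Lp p lam \<Longrightarrow> ?d f \<le> ennreal M * min (?n (F f)) (?n (G f))"
      by blast
    \<comment> \<open>As \<open>1 < M\<close>, the same constant also covers the norm of
      \<open>F f\<close> or \<open>G f\<close> itself; the maximum is what the quasi-triangle
      inequality leaves to be estimated.\<close>
    have dF: "max (?d f) (?n (F f)) \<le> ennreal M * ?n (F f)"
      and dG: "max (?d f) (?n (G f)) \<le> ennreal M * ?n (G f)" if "f \<in> Lp p lam" for f
    proof -
      have self: "x \<le> ennreal M * x" for x
        using M mult_right_mono[of 1 "ennreal M" x] by simp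
      have "ennreal M * min (?n (F f)) (?n (G f)) \<le> ennreal M * ?n (F f)"
        "ennreal M * min (?n (F f)) (?n (G f)) \<le> ennreal M * ?n (G f)"
        by (auto intro!: mult_left_mono)
      with d[OF that] self show "max (?d f) (?n (F f)) \<le> ennreal M * ?n (F f)"
        "max (?d f) (?n (G f)) \<le> ennreal M * ?n (G f)"
        by (auto intro: order_trans)
    qed
    \<comment> \<open>Either transform is recovered from the other one and their difference.\<close>
    have tri: "norm x \<le> norm (x - y) + norm y" "norm y \<le> norm (x - y) + norm x" for x y :: complex
      using norm_triangle_sub[of x y] norm_triangle_sub[of y x] by (auto simp: norm_minus_commute)
    have FG: "?n (F f) \<le> ennreal (4 * M) * ?n (G f)" if f: "f \<in> Lp p lam" for f
    proof -
      have "?n (F f) \<le> ennreal 4 * max (?d f) (?n (G f))"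
        using f by (intro Lp_norm_le_max borel_measurable_diff meas q(2) tri)
      from ennreal_mult_le_trans[OF this dG[OF f]] show ?thesis by simp
    qed
    have GF: "?n (G f) \<le> ennreal (4 * M) * ?n (F f)" if f: "f \<in> Lp p lam" for f
    proof -
      have "?n (G f) \<le> ennreal 4 * max (?d f) (?n (F f))"
        using f by (intro Lp_norm_le_max borel_measurable_diff meas q(2) tri)
      from ennreal_mult_le_trans[OF this dF[OF f]] show ?thesis by simp
    qed
    \<comment> \<open>The norm of \<open>f\<close> is compared with that of \<open>G f\<close> by
      way of \<open>F f\<close>, and the constants of the two comparisons are multiplied.\<close>
    show "frame_measure p q lam \<nu>"
      unfolding frame_measure_iff[OF q(1)]
    proof (rule conjI[OF sets], rule exI[of _ "D * a * (4 * M)"],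
        rule exI[of _ "4 * M * (b * C)"], intro conjI ballI)
      fix f assume f: "f \<in> Lp p lam"
      show "Lp_norm p lam f \<le> ennreal (D * a * (4 * M)) * ?n (fourier_transform lam f)"
        using ennreal_mult_le_trans[OF F_lo[OF f] FG[OF f]] CD ab by (simp add: G_def)
      show "?n (fourier_transform lam f) \<le> ennreal (4 * M * (b * C)) * Lp_norm p lam f"
        using ennreal_mult_le_trans[OF GF[OF f] F_up[OF f]] M by (simp add: G_def)
    qed (use CD ab M in auto)
  qed
  then show ?thesis
    by (simp add: F_def G_def)
qed

end
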